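(* We have $\mathcal{R}_q=\mathcal{R}_q^{+}\otimes_{\mathbb{Z}[q]}\mathbb{Z}[q,q^{-1}]$, viewed as subrings of $\mathbb{Q}(q)[x]$ (where the tensor product is viewed inside $\mathbb{Q}(q)[x]$ via the multiplication map $P\otimes c\mapsto cP$).
   Context: Here $q$ and $x$ are commuting indeterminates, $\mathbb{N}=\{0,1,2,\dots\}$, and for $n\in\mathbb{Z}$, $[n]_q:=(q^n-1)/(q-1)\in\mathbb{Z}[q,q^{-1}]$. The rings are $\mathcal{R}_q^{+}:=\{P(x)\in\mathbb{Q}(q)[x] : P([n]_q)\in\mathbb{Z}[q]\text{ for all }n\in\mathbb{N}\}$, a $\mathbb{Z}[q]$-algebra, and $\mathcal{R}_q:=\{P(x)\in\mathbb{Q}(q)[x] : P([n]_q)\in\mathbb{Z}[q,q^{-1}]\text{ for all }n\in\mathbb{Z}\}$, a $\mathbb{Z}[q,q^{-1}]$-algebra. *)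

theory Defs
  imports
    "HOL-Computational_Algebra.Computational_Algebra"
    "HOL-Library.Poly_Mapping"
    "HOL-Algebra.Module"
    "HOL-Algebra.QuotRing"
    "HOL-Algebra.Generated_Groups"
begin

section \<open>Tensor products of algebras\<close>

text \<open>
  The free abelian group on \<open>A \<times> B\<close>, realised as finitely supported integer-valued functions,
  with the multiplication that extends \<open>(a, b) \<cdot> (a', b') = (a a', b b')\<close> biadditively.
\<close>

definition tensor_free ::
  "('a, 'm) ring_scheme \<Rightarrow> ('b, 'n) ring_scheme \<Rightarrow> ('a \<times> 'b \<Rightarrow>\<^sub>0 int) ring" where
  "tensor_free A B =
     \<lparr>carrier = {z. Poly_Mapping.keys z \<subseteq> carrier A \<times> carrier B},
      monoid.mult = (\<lambda>z w. frag_extend (\<lambda>(a, b). frag_extend (\<lambda>(a', b').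
        frag_of (a \<otimes>\<^bsub>A\<^esub> a', b \<otimes>\<^bsub>B\<^esub> b')) w) z),
      one = frag_of (\<one>\<^bsub>A\<^esub>, \<one>\<^bsub>B\<^esub>),
      zero = 0,
      add = (+)\<rparr>"

definition tensor_rels ::
  "('r, 'k) ring_scheme \<Rightarrow> ('r, 'a, 'm) module_scheme \<Rightarrow> ('r, 'b, 'n) module_scheme
    \<Rightarrow> ('a \<times> 'b \<Rightarrow>\<^sub>0 int) set" where
  "tensor_rels R A B =
     {frag_of (a \<oplus>\<^bsub>A\<^esub> a', b) - frag_of (a, b) - frag_of (a', b) | a a' b.
        a \<in> carrier A \<and> a' \<in> carrier A \<and> b \<in> carrier B} \<union>
     {frag_of (a, b \<oplus>\<^bsub>B\<^esub> b') - frag_of (a, b) - frag_of (a, b') | a b b'.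
        a \<in> carrier A \<and> b \<in> carrier B \<and> b' \<in> carrier B} \<union>
     {frag_of (r \<odot>\<^bsub>A\<^esub> a, b) - frag_of (a, r \<odot>\<^bsub>B\<^esub> b) | r a b.
        r \<in> carrier R \<and> a \<in> carrier A \<and> b \<in> carrier B}"

text \<open>
  Only the additive subgroup generated by the relations is divided out, so additively this is the
  tensor product of modules.  If \<open>A\<close> and \<open>B\<close> are \<open>R\<close>-algebras, the relations are stable under
  multiplication by the basis elements \<open>(a, b)\<close>, so that this subgroup is an ideal and the
  multiplication of cosets is the usual one.
\<close>

definition tensor_kernel ::
  "('r, 'k) ring_scheme \<Rightarrow> ('r, 'a, 'm) module_scheme \<Rightarrow> ('r, 'b, 'n) module_scheme
    \<Rightarrow> ('a \<times> 'b \<Rightarrow>\<^sub>0 int) set" where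
  "tensor_kernel R A B = generate (add_monoid (tensor_free A B)) (tensor_rels R A B)"

definition tensor_algebra ::
  "('r, 'k) ring_scheme \<Rightarrow> ('r, 'a, 'm) module_scheme \<Rightarrow> ('r, 'b, 'n) module_scheme
    \<Rightarrow> ('a \<times> 'b \<Rightarrow>\<^sub>0 int) set ring" where
  "tensor_algebra R A B = tensor_free A B Quot tensor_kernel R A B"

definition pure_tensor ::
  "('r, 'k) ring_scheme \<Rightarrow> ('r, 'a, 'm) module_scheme \<Rightarrow> ('r, 'b, 'n) module_scheme
    \<Rightarrow> 'a \<Rightarrow> 'b \<Rightarrow> ('a \<times> 'b \<Rightarrow>\<^sub>0 int) set" where
  "pure_tensor R A B a b = tensor_kernel R A B +>\<^bsub>tensor_free A B\<^esub> frag_of (a, b)"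


section \<open>The rings of \<open>q\<close>-integer-valued polynomials\<close>

type_synonym ratfun = "rat poly fract"

definition qvar :: ratfun where
  "qvar = to_fract [:0, 1:]"

definition Zq :: "ratfun set" where
  "Zq = range (\<lambda>p :: int poly. to_fract (map_poly rat_of_int p))"

definition Zq_laurent :: "ratfun set" where
  "Zq_laurent = {c / qvar ^ k | c k. c \<in> Zq}"

definition qint :: "int \<Rightarrow> ratfun" where
  "qint n = (qvar powi n - 1) / (qvar - 1)"

definition Rq_plus :: "ratfun poly set" where
  "Rq_plus = {P. \<forall>n :: nat. poly P (qint (int n)) \<in> Zq}"

definition Rq :: "ratfun poly set" where
  "Rq = {P. \<forall>n :: int. poly P (qint n) \<in> Zq_laurent}"

definition Qqx_ring :: "ratfun poly ring" where
  "Qqx_ring = \<lparr>carrier = UNIV, monoid.mult = (*), one = 1, zero = 0, add = (+)\<rparr>"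

definition Zq_ring :: "ratfun ring" where
  "Zq_ring = \<lparr>carrier = Zq, monoid.mult = (*), one = 1, zero = 0, add = (+)\<rparr>"

definition Zq_laurent_alg :: "(ratfun, ratfun) module" where
  "Zq_laurent_alg =
     \<lparr>carrier = Zq_laurent, monoid.mult = (*), one = 1, zero = 0, add = (+), smult = (*)\<rparr>"

definition Rq_plus_alg :: "(ratfun, ratfun poly) module" where
  "Rq_plus_alg =
     \<lparr>carrier = Rq_plus, monoid.mult = (*), one = 1, zero = 0, add = (+), smult = Polynomial.smult\<rparr>"

abbreviation Rq_tensor :: "(ratfun poly \<times> ratfun \<Rightarrow>\<^sub>0 int) set ring" where
  "Rq_tensor \<equiv> tensor_algebra Zq_ring Rq_plus_alg Zq_laurent_alg"

abbreviation Rq_pure :: "ratfun poly \<Rightarrow> ratfun \<Rightarrow> (ratfun poly \<times> ratfun \<Rightarrow>\<^sub>0 int) set" where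
  "Rq_pure \<equiv> pure_tensor Zq_ring Rq_plus_alg Zq_laurent_alg"

definition mult_free :: "(ratfun poly \<times> ratfun \<Rightarrow>\<^sub>0 int) \<Rightarrow> ratfun poly" where
  "mult_free z = (\<Sum>(P, c) \<in> Poly_Mapping.keys z.
     of_int (Poly_Mapping.lookup z (P, c)) * Polynomial.smult c P)"

text \<open>
  The multiplication map on the tensor product: \<open>mult_free\<close> is constant on the cosets, and
  \<open>the_elem\<close> extracts the common value.
\<close>

definition mult_map :: "(ratfun poly \<times> ratfun \<Rightarrow>\<^sub>0 int) set \<Rightarrow> ratfun poly" where
  "mult_map X = the_elem (mult_free ` X)"

end

theory Submission
  imports Defs
begin

text \<open>
  Put \<open>L = \<int>[q, q^-1]\<close>.  Two things have to be seen: that the multiplication map on the tensor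
  product is injective with image the union of the sets \<open>q^-k R\<^sub>q\<^sup>+\<close>, and that this union is \<open>R\<^sub>q\<close>.

  The first is the usual description of a localization.  Modulo the tensor relations one can move
  elements of \<open>\<int>[q]\<close> from the right factor to the left one and bring finitely many terms to a common
  denominator, so every element of the tensor product is of the form \<open>P \<otimes> q^-k\<close>
  (\<open>tensor_normal_form\<close>).  Its image \<open>q^-k P\<close> vanishes only if \<open>P = 0\<close>.

  For the second, substitute \<open>x = (y - 1) / (q - 1)\<close>, so that \<open>P([n]\<^sub>q)\<close> becomes \<open>f(q^n)\<close> for a
  polynomial \<open>f\<close> in \<open>y\<close>.  If \<open>f\<close> has degree at most \<open>d\<close>, the leading terms cancel in
  \<open>g(y) = f(q y) - q^d f(y)\<close>, so \<open>g\<close> has degree less than \<open>d\<close> and induction on the degree applies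
  to it.  The relation \<open>f(q^(n+1)) = g(q^n) + q^d f(q^n)\<close> can be run in both directions:

  \<^item> backwards, where \<open>q^d\<close> has to be inverted: if \<open>f(q^n) \<in> L\<close> for all \<open>n \<ge> 0\<close>, then also for all
    \<open>n < 0\<close>; hence \<open>R\<^sub>q\<^sup>+ \<subseteq> R\<^sub>q\<close> (\<open>poly_qpower_mem_if_nonneg\<close>);

  \<^item> forwards, where only \<open>q^d \<in> \<int>[q]\<close> is used: a power of \<open>q\<close> that clears the denominators of
    \<open>f(1)\<close> and of all \<open>g(q^n)\<close> clears those of all \<open>f(q^n)\<close>, \<open>n \<ge> 0\<close>; hence each \<open>P \<in> R\<^sub>q\<close> has a
    multiple \<open>q^k P \<in> R\<^sub>q\<^sup>+\<close> (\<open>poly_qpower_common_denominator\<close>).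
\<close>

section \<open>Sequences that are polynomial in powers of q\<close>

definition subring_set :: "'a::comm_ring_1 set \<Rightarrow> bool" where
  "subring_set A \<longleftrightarrow> 1 \<in> A \<and> (\<forall>a\<in>A. \<forall>b\<in>A. a - b \<in> A \<and> a * b \<in> A)"

lemma subring_setD:
  assumes "subring_set A"
  shows "1 \<in> A" "0 \<in> A"
    and "\<And>a b. a \<in> A \<Longrightarrow> b \<in> A \<Longrightarrow> a - b \<in> A"
    and "\<And>a. a \<in> A \<Longrightarrow> - a \<in> A"
    and "\<And>a b. a \<in> A \<Longrightarrow> b \<in> A \<Longrightarrow> a + b \<in> A"
    and "\<And>a b. a \<in> A \<Longrightarrow> b \<in> A \<Longrightarrow> a * b \<in> A"
    and "\<And>a n. a \<in> A \<Longrightarrow> a ^ n \<in> A"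
proof -
  show one: "1 \<in> A" and diff: "\<And>a b. a \<in> A \<Longrightarrow> b \<in> A \<Longrightarrow> a - b \<in> A"
    and mult: "\<And>a b. a \<in> A \<Longrightarrow> b \<in> A \<Longrightarrow> a * b \<in> A"
    using assms by (auto simp: subring_set_def)
  show zero: "0 \<in> A" using diff[OF one one] by simp
  show neg: "- a \<in> A" if "a \<in> A" for a using diff[OF zero that] by simp
  show "a + b \<in> A" if "a \<in> A" "b \<in> A" for a b using diff[OF that(1) neg[OF that(2)]] by simp
  show "a ^ n \<in> A" if "a \<in> A" for a n using one mult that by (induction n) auto
qed

definition qdiff :: "'a::field \<Rightarrow> nat \<Rightarrow> 'a poly \<Rightarrow> 'a poly" where
  "qdiff q d f = pcompose f [:0, q:] - Polynomial.smult (q ^ d) f"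

lemma poly_qdiff: "poly (qdiff q d f) y = poly f (q * y) - q ^ d * poly f y"
  by (simp add: qdiff_def poly_pcompose mult.commute)

text \<open>
  The substitution \<open>y \<mapsto> q y\<close> multiplies the coefficient of \<open>y\<^sup>d\<close> by \<open>q^d\<close>, so the subtraction cancels
  the term of degree \<open>d\<close>.  The degree bound is put as vanishing of coefficients, so that the bound
  \<open>0\<close> means the zero polynomial and can start an induction.
\<close>

lemma coeff_qdiff_eq_0:
  assumes "\<And>i. i \<ge> Suc d \<Longrightarrow> coeff f i = 0" "i \<ge> d"
  shows "coeff (qdiff q d f) i = 0"
  using assms by (cases "i = d") (auto simp: qdiff_def coeff_pcompose_linear)

text \<open>
  The step from \<open>n + 1\<close> to \<open>n\<close> solves the recurrence for the earlier value,
  \<open>f(q^n) = q^-d (f(q^(n+1)) - g(q^n))\<close> with \<open>g = qdiff q d f\<close>; this is where \<open>q\<close> must be a unit of \<open>A\<close>.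
\<close>

lemma poly_qpower_mem_if_nonneg:
  fixes q :: "'a::field"
  assumes A: "subring_set A" and q: "q \<in> A" "inverse q \<in> A" "q \<noteq> 0"
    and "\<And>i. i \<ge> d \<Longrightarrow> coeff f i = 0"
    and "\<And>n::nat. poly f (q ^ n) \<in> A"
  shows "poly f (q powi n) \<in> A"
  using assms(5,6)
proof (induction d arbitrary: f n)
  case 0
  then have "f = 0" by (simp add: poly_eq_iff)
  then show ?case using subring_setD[OF A] by simp
next
  case (Suc d)
  have g: "poly (qdiff q d f) (q powi m) \<in> A" for m
  proof (rule Suc.IH)
    show "coeff (qdiff q d f) i = 0" if "i \<ge> d" for i
      using coeff_qdiff_eq_0[OF Suc.prems(1) that] .
    show "poly (qdiff q d f) (q ^ k) \<in> A" for k
      using Suc.prems(2)[of k] Suc.prems(2)[of "Suc k"] q subring_setD[OF A]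
      by (simp add: poly_qdiff)
  qed
  have neg: "poly f (q powi (- int k)) \<in> A" for k
  proof (induction k)
    case 0
    show ?case using Suc.prems(2)[of 0] by simp
  next
    case (Suc k)
    have e: "q * q powi (- int (Suc k)) = q powi (- int k)"
      using power_int_add[of q 1 "- int (Suc k)"] q(3) by simp
    have "poly f (q powi (- int (Suc k))) =
        inverse q ^ d * (poly f (q powi (- int k)) - poly (qdiff q d f) (q powi (- int (Suc k))))"
      unfolding poly_qdiff e using q(3) by (simp add: power_inverse)
    then show ?case using Suc g q subring_setD[OF A] by metis
  qed
  show ?case
  proof (cases "n \<ge> 0")
    case True
    then show ?thesis using Suc.prems(2)[of "nat n"] by (simp add: power_int_def)
  next
    case False
    then show ?thesis using neg[of "nat (- n)"] by simp
  qed
qed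

text \<open>
  A priori the denominator \<open>q^k\<close> of \<open>f(q^n)\<close> may grow with \<open>n\<close>.  It does not, because the
  recurrence \<open>f(q^(n+1)) = g(q^n) + q^d f(q^n)\<close> has coefficients in \<open>A\<close>: a bound for the values of \<open>g\<close> and
  for the single value \<open>f(1)\<close> propagates to all \<open>n\<close>.
\<close>

lemma poly_qpower_common_denominator:
  fixes q :: "'a::field"
  assumes A: "subring_set A" and q: "q \<in> A"
    and "\<And>i. i \<ge> d \<Longrightarrow> coeff f i = 0"
    and "\<And>n::nat. \<exists>k. q ^ k * poly f (q ^ n) \<in> A"
  shows "\<exists>k. \<forall>n::nat. q ^ k * poly f (q ^ n) \<in> A"
  using assms(3,4)
proof (induction d arbitrary: f)
  case 0
  then have "f = 0" by (simp add: poly_eq_iff)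
  then show ?case using subring_setD[OF A] by simp
next
  case (Suc d)
  have raise: "q ^ l * x \<in> A" if "q ^ k * x \<in> A" "k \<le> l" for k l x
  proof -
    have "q ^ l * x = q ^ (l - k) * (q ^ k * x)"
      using that(2) by (simp add: mult.assoc[symmetric] power_add[symmetric])
    then show ?thesis using that(1) q subring_setD[OF A] by metis
  qed
  have "\<exists>k. \<forall>n::nat. q ^ k * poly (qdiff q d f) (q ^ n) \<in> A"
  proof (rule Suc.IH)
    show "coeff (qdiff q d f) i = 0" if "i \<ge> d" for i
      using coeff_qdiff_eq_0[OF Suc.prems(1) that] .
    show "\<exists>k. q ^ k * poly (qdiff q d f) (q ^ n) \<in> A" for n
    proof -
      obtain k l where k: "q ^ k * poly f (q ^ n) \<in> A" and l: "q ^ l * poly f (q ^ Suc n) \<in> A"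
        using Suc.prems(2) by metis
      have "q ^ max k l * poly (qdiff q d f) (q ^ n) =
          q ^ max k l * poly f (q ^ Suc n) - q ^ d * (q ^ max k l * poly f (q ^ n))"
        by (simp add: poly_qdiff algebra_simps)
      also have "\<dots> \<in> A"
        using raise[OF k, of "max k l"] raise[OF l, of "max k l"] q subring_setD[OF A] by auto
      finally show ?thesis by blast
    qed
  qed
  then obtain k where k: "\<And>n::nat. q ^ k * poly (qdiff q d f) (q ^ n) \<in> A" by blast
  obtain l where l: "q ^ l * poly f (q ^ 0) \<in> A" using Suc.prems(2) by blast
  have "q ^ max k l * poly f (q ^ n) \<in> A" for n
  proof (induction n)
    case 0
    show ?case using raise[OF l, of "max k l"] by simp
  next
    case (Suc n)
    have "q ^ max k l * poly f (q ^ Suc n) =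
        q ^ max k l * poly (qdiff q d f) (q ^ n) + q ^ d * (q ^ max k l * poly f (q ^ n))"
      by (simp add: poly_qdiff algebra_simps)
    also have "\<dots> \<in> A"
      using Suc raise[OF k, of "max k l"] q subring_setD[OF A] by auto
    finally show ?case .
  qed
  then show ?case by blast
qed

section \<open>Integral polynomials and Laurent polynomials in q\<close>

lemma subring_set_Zq: "subring_set Zq"
proof -
  let ?h = "\<lambda>p :: int poly. map_poly rat_of_int p"
  have one: "?h 1 = 1" by (simp add: map_poly_1)
  have diff: "?h (p - r) = ?h p - ?h r" for p r
    by (simp add: poly_eq_iff coeff_map_poly)
  have mult: "?h (p * r) = ?h p * ?h r" for p r
    by (simp add: poly_eq_iff coeff_map_poly coeff_mult)
  have "1 = to_fract (?h 1)" by (simp add: one)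
  moreover have "to_fract (?h p) - to_fract (?h r) = to_fract (?h (p - r))" for p r
    by (simp add: diff)
  moreover have "to_fract (?h p) * to_fract (?h r) = to_fract (?h (p * r))" for p r
    by (simp add: mult)
  ultimately show ?thesis
    unfolding subring_set_def Zq_def by blast
qed

lemmas Zq_closed = subring_setD[OF subring_set_Zq]

lemma qvar_mem_Zq: "qvar \<in> Zq"
proof -
  have "map_poly rat_of_int [:0, 1:] = [:0, 1:]" by (simp add: map_poly_pCons)
  then show ?thesis unfolding Zq_def qvar_def by (metis rangeI)
qed

lemma qvar_nonzero: "qvar \<noteq> 0"
  by (simp add: qvar_def)

lemma qvar_neq_1: "qvar \<noteq> 1"
proof
  assume "qvar = 1"
  then have "to_fract [:0, 1:] = to_fract (1 :: rat poly)" by (simp add: qvar_def)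
  then have "[:0, 1:] = (1 :: rat poly)" by (simp only: to_fract_eq_iff)
  then show False by (simp add: one_pCons)
qed

lemma Zq_laurent_iff: "x \<in> Zq_laurent \<longleftrightarrow> (\<exists>k. qvar ^ k * x \<in> Zq)"
proof
  assume "x \<in> Zq_laurent"
  then obtain c k where "x = c / qvar ^ k" "c \<in> Zq" by (auto simp: Zq_laurent_def)
  then have "qvar ^ k * x \<in> Zq" using qvar_nonzero by simp
  then show "\<exists>k. qvar ^ k * x \<in> Zq" ..
next
  assume "\<exists>k. qvar ^ k * x \<in> Zq"
  then obtain k where "qvar ^ k * x \<in> Zq" ..
  moreover have "x = (qvar ^ k * x) / qvar ^ k" using qvar_nonzero by simp
  ultimately show "x \<in> Zq_laurent" unfolding Zq_laurent_def by blast
qed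

lemma Zq_subset_Zq_laurent: "Zq \<subseteq> Zq_laurent"
  by (auto simp: Zq_laurent_iff) (metis mult_1 power_0)

lemma inverse_qvar_power_mem: "1 / qvar ^ k \<in> Zq_laurent"
  using Zq_closed(1) by (auto simp: Zq_laurent_def)

lemma subring_set_Zq_laurent: "subring_set Zq_laurent"
  unfolding subring_set_def
proof (intro conjI ballI)
  show "1 \<in> Zq_laurent" using Zq_subset_Zq_laurent Zq_closed(1) by blast
  fix a b assume "a \<in> Zq_laurent" "b \<in> Zq_laurent"
  then obtain k l where k: "qvar ^ k * a \<in> Zq" and l: "qvar ^ l * b \<in> Zq"
    by (auto simp: Zq_laurent_iff)
  have "qvar ^ (k + l) * (a - b) = qvar ^ l * (qvar ^ k * a) - qvar ^ k * (qvar ^ l * b)"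
    by (simp add: power_add algebra_simps)
  also have "\<dots> \<in> Zq"
    by (rule Zq_closed(3)[OF Zq_closed(6)[OF Zq_closed(7)[OF qvar_mem_Zq] k]
      Zq_closed(6)[OF Zq_closed(7)[OF qvar_mem_Zq] l]])
  finally show "a - b \<in> Zq_laurent" unfolding Zq_laurent_iff by blast
  have "qvar ^ (k + l) * (a * b) = (qvar ^ k * a) * (qvar ^ l * b)"
    by (simp add: power_add algebra_simps)
  also have "\<dots> \<in> Zq" by (rule Zq_closed(6)[OF k l])
  finally show "a * b \<in> Zq_laurent" unfolding Zq_laurent_iff by blast
qed

lemmas Zq_laurent_closed = subring_setD[OF subring_set_Zq_laurent]

section \<open>Comparison of the two rings of q-integer-valued polynomials\<close>

text \<open>
  The polynomial \<open>P\<close> rewritten in the variable \<open>y = 1 + (q - 1) x\<close>, which takes the value \<open>q^n\<close>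
  at \<open>x = [n]\<^sub>q\<close>.
\<close>

definition in_qpower :: "ratfun poly \<Rightarrow> ratfun poly" where
  "in_qpower P = pcompose P [:- 1 / (qvar - 1), 1 / (qvar - 1):]"

lemma poly_in_qpower: "poly (in_qpower P) (qvar powi n) = poly P (qint n)"
  by (simp add: in_qpower_def poly_pcompose qint_def diff_divide_distrib)

lemma poly_in_qpower_nat: "poly (in_qpower P) (qvar ^ n) = poly P (qint (int n))"
  using poly_in_qpower[of P "int n"] by simp

lemma coeff_in_qpower_eq_0: "i \<ge> Suc (degree (in_qpower P)) \<Longrightarrow> coeff (in_qpower P) i = 0"
  by (simp add: coeff_eq_0)

lemma Rq_plus_subset_Rq: "Rq_plus \<subseteq> Rq"
proof
  fix P assume P: "P \<in> Rq_plus"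
  have "poly (in_qpower P) (qvar powi n) \<in> Zq_laurent" for n
  proof (rule poly_qpower_mem_if_nonneg[OF subring_set_Zq_laurent _ _ qvar_nonzero
        coeff_in_qpower_eq_0])
    show "qvar \<in> Zq_laurent" using qvar_mem_Zq Zq_subset_Zq_laurent by blast
    show "inverse qvar \<in> Zq_laurent" using inverse_qvar_power_mem[of 1] by (simp add: divide_simps)
    show "poly (in_qpower P) (qvar ^ m) \<in> Zq_laurent" for m :: nat
      unfolding poly_in_qpower_nat using P Zq_subset_Zq_laurent unfolding Rq_plus_def by blast
  qed
  then show "P \<in> Rq" by (simp add: Rq_def poly_in_qpower)
qed

lemma Rq_common_denominator:
  assumes "P \<in> Rq"
  shows "\<exists>k. Polynomial.smult (qvar ^ k) P \<in> Rq_plus"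
proof -
  have "\<exists>k. \<forall>n::nat. qvar ^ k * poly (in_qpower P) (qvar ^ n) \<in> Zq"
  proof (rule poly_qpower_common_denominator[OF subring_set_Zq qvar_mem_Zq coeff_in_qpower_eq_0])
    show "\<exists>k. qvar ^ k * poly (in_qpower P) (qvar ^ n) \<in> Zq" for n :: nat
      unfolding poly_in_qpower_nat Zq_laurent_iff[symmetric] using assms by (simp add: Rq_def)
  qed
  then show ?thesis by (simp add: Rq_plus_def poly_in_qpower_nat)
qed

lemma Rq_plus_closed:
  shows "0 \<in> Rq_plus"
    and "P \<in> Rq_plus \<Longrightarrow> Q \<in> Rq_plus \<Longrightarrow> P + Q \<in> Rq_plus"
    and "P \<in> Rq_plus \<Longrightarrow> Q \<in> Rq_plus \<Longrightarrow> P - Q \<in> Rq_plus"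
    and "c \<in> Zq \<Longrightarrow> P \<in> Rq_plus \<Longrightarrow> Polynomial.smult c P \<in> Rq_plus"
  by (simp_all add: Rq_plus_def Zq_closed)

lemma Rq_smult: "c \<in> Zq_laurent \<Longrightarrow> P \<in> Rq \<Longrightarrow> Polynomial.smult c P \<in> Rq"
  by (simp add: Rq_def Zq_laurent_closed)

section \<open>The multiplication map on formal sums\<close>

lemma mult_free_superset:
  assumes "finite S" "Poly_Mapping.keys z \<subseteq> S"
  shows "mult_free z =
    (\<Sum>(P, c)\<in>S. of_int (Poly_Mapping.lookup z (P, c)) * Polynomial.smult c P)"
  unfolding mult_free_def using assms
  by (intro sum.mono_neutral_left) (auto simp: in_keys_iff)

lemma mult_free_diff: "mult_free (z - w) = mult_free z - mult_free w"
proof -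
  let ?S = "Poly_Mapping.keys z \<union> Poly_Mapping.keys w"
  have "Poly_Mapping.keys (z - w) \<subseteq> ?S" by (rule keys_diff)
  then show ?thesis
    by (simp add: mult_free_superset[of ?S] sum_subtractf[symmetric] lookup_minus
        case_prod_unfold left_diff_distrib smult_diff_right)
qed

lemma mult_free_0 [simp]: "mult_free 0 = 0"
  by (simp add: mult_free_def)

lemma mult_free_uminus: "mult_free (- z) = - mult_free z"
  using mult_free_diff[of 0 z] by simp

lemma mult_free_add: "mult_free (z + w) = mult_free z + mult_free w"
  using mult_free_diff[of z "- w"] by (simp add: mult_free_uminus)

lemma mult_free_frag_of [simp]: "mult_free (frag_of (P, c)) = Polynomial.smult c P"
  by (simp add: mult_free_def)

text \<open>
  Both sides are additive in \<open>z\<close>, so it suffices to compare generators.  With \<open>u\<close> a multiplication by a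
  fixed polynomial, this lemma is used once in each argument of the product of formal sums.
\<close>

lemma mult_free_frag_extend:
  assumes "\<And>x. mult_free (h x) = u (mult_free (frag_of x))"
    and "u 0 = 0" and "\<And>a b. u (a - b) = u a - u b"
  shows "mult_free (frag_extend h z) = u (mult_free z)"
proof -
  have "Poly_Mapping.keys z \<subseteq> UNIV" by simp
  then show ?thesis
    by (induction rule: frag_induction)
       (simp_all add: assms frag_extend_diff mult_free_diff del: mult_free_frag_of)
qed

lemma Rq_alg_simps:
  "carrier Zq_ring = Zq" "carrier Rq_plus_alg = Rq_plus" "carrier Zq_laurent_alg = Zq_laurent"
  "P \<oplus>\<^bsub>Rq_plus_alg\<^esub> Q = P + Q" "b \<oplus>\<^bsub>Zq_laurent_alg\<^esub> c = b + c"
  "P \<otimes>\<^bsub>Rq_plus_alg\<^esub> Q = P * Q" "b \<otimes>\<^bsub>Zq_laurent_alg\<^esub> c = b * c"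
  "\<one>\<^bsub>Rq_plus_alg\<^esub> = 1" "\<one>\<^bsub>Zq_laurent_alg\<^esub> = 1"
  "r \<odot>\<^bsub>Rq_plus_alg\<^esub> P = Polynomial.smult r P" "r \<odot>\<^bsub>Zq_laurent_alg\<^esub> c = r * c"
  by (simp_all add: Zq_ring_def Rq_plus_alg_def Zq_laurent_alg_def)

abbreviation (input) Rq_free :: "(ratfun poly \<times> ratfun \<Rightarrow>\<^sub>0 int) ring" where
  "Rq_free \<equiv> tensor_free Rq_plus_alg Zq_laurent_alg"

abbreviation (input) Rq_kernel :: "(ratfun poly \<times> ratfun \<Rightarrow>\<^sub>0 int) set" where
  "Rq_kernel \<equiv> tensor_kernel Zq_ring Rq_plus_alg Zq_laurent_alg"

abbreviation (input) Rq_rels :: "(ratfun poly \<times> ratfun \<Rightarrow>\<^sub>0 int) set" where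
  "Rq_rels \<equiv> tensor_rels Zq_ring Rq_plus_alg Zq_laurent_alg"

lemma mult_free_mult: "mult_free (z \<otimes>\<^bsub>Rq_free\<^esub> w) = mult_free z * mult_free w"
proof -
  have "mult_free (frag_extend (\<lambda>(a', b'). frag_of (a * a', b * b')) w) =
      Polynomial.smult b a * mult_free w" for a b
    by (rule mult_free_frag_extend) (auto simp: algebra_simps smult_diff_right)
  then have "mult_free (frag_extend (\<lambda>(a, b).
      frag_extend (\<lambda>(a', b'). frag_of (a * a', b * b')) w) z) = mult_free z * mult_free w"
    by (intro mult_free_frag_extend) (auto simp: algebra_simps)
  then show ?thesis by (simp add: tensor_free_def Rq_alg_simps)
qed

section \<open>The kernel of the multiplication map\<close>

lemma tensor_free_add:
  assumes "z \<in> carrier (tensor_free A B)" "w \<in> carrier (tensor_free A B)"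
  shows "z + w \<in> carrier (tensor_free A B)"
  using assms keys_add[of z w] by (auto simp: tensor_free_def)

lemma tensor_free_diff:
  assumes "z \<in> carrier (tensor_free A B)" "w \<in> carrier (tensor_free A B)"
  shows "z - w \<in> carrier (tensor_free A B)"
  using assms keys_diff[of z w] by (auto simp: tensor_free_def)

lemma group_add_tensor_free: "group (add_monoid (tensor_free A B))"
proof (rule groupI)
  let ?G = "add_monoid (tensor_free A B)"
  show "x \<otimes>\<^bsub>?G\<^esub> y \<in> carrier ?G" if "x \<in> carrier ?G" "y \<in> carrier ?G" for x y
    using that tensor_free_add[of x A B y] by (simp add: tensor_free_def)
  show "\<exists>y\<in>carrier ?G. y \<otimes>\<^bsub>?G\<^esub> x = \<one>\<^bsub>?G\<^esub>" if "x \<in> carrier ?G" for x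
    using that by (intro bexI[of _ "- x"]) (simp_all add: tensor_free_def)
qed (simp_all add: tensor_free_def add.assoc)

lemma frag_of_mem_Rq_free: "frag_of (P, c) \<in> carrier Rq_free \<longleftrightarrow> P \<in> Rq_plus \<and> c \<in> Zq_laurent"
  by (simp add: tensor_free_def Rq_alg_simps)

lemma Rq_rels_subset_carrier: "Rq_rels \<subseteq> carrier Rq_free"
  unfolding tensor_rels_def
  using Zq_subset_Zq_laurent
  by (auto simp: frag_of_mem_Rq_free Rq_alg_simps Rq_plus_closed Zq_laurent_closed subset_iff
      intro!: tensor_free_diff)

lemma Rq_kernel_subgroup: "subgroup Rq_kernel (add_monoid Rq_free)"
  unfolding tensor_kernel_def
  by (rule group.generate_is_subgroup[OF group_add_tensor_free])
     (use Rq_rels_subset_carrier in simp)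

lemma Rq_kernel_add:
  assumes "z \<in> Rq_kernel" "w \<in> Rq_kernel" shows "z + w \<in> Rq_kernel"
  using subgroup.m_closed[OF Rq_kernel_subgroup assms] by (simp add: tensor_free_def)

lemma Rq_kernel_zero: "0 \<in> Rq_kernel"
  using subgroup.one_closed[OF Rq_kernel_subgroup] by (simp add: tensor_free_def)

lemma inv_tensor_free:
  assumes "z \<in> carrier (tensor_free A B)"
  shows "inv\<^bsub>add_monoid (tensor_free A B)\<^esub> z = - z"
  by (rule group.inv_equality[OF group_add_tensor_free]) (use assms in \<open>auto simp: tensor_free_def\<close>)

lemma Rq_kernel_uminus:
  assumes "z \<in> Rq_kernel" shows "- z \<in> Rq_kernel"
proof -
  have "z \<in> carrier Rq_free" using subgroup.subset[OF Rq_kernel_subgroup] assms by auto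
  then show ?thesis
    using subgroup.m_inv_closed[OF Rq_kernel_subgroup assms] by (simp only: inv_tensor_free)
qed

lemma Rq_kernel_diff:
  assumes "z \<in> Rq_kernel" "w \<in> Rq_kernel" shows "z - w \<in> Rq_kernel"
  using Rq_kernel_add[OF assms(1) Rq_kernel_uminus[OF assms(2)]] by simp

lemma mult_free_Rq_rels: "z \<in> Rq_rels \<Longrightarrow> mult_free z = 0"
  by (auto simp: tensor_rels_def mult_free_diff Rq_alg_simps
      smult_add_left smult_add_right mult.commute)

lemma mult_free_Rq_kernel:
  assumes "z \<in> Rq_kernel" shows "mult_free z = 0"
  using assms unfolding tensor_kernel_def
proof (induction rule: generate.induct)
  case one
  then show ?case by (simp add: tensor_free_def)
next
  case (incl h)
  then show ?case by (rule mult_free_Rq_rels)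
next
  case (inv h)
  then have "h \<in> carrier Rq_free" using Rq_rels_subset_carrier by blast
  then show ?case by (simp only: inv_tensor_free mult_free_uminus mult_free_Rq_rels[OF inv] minus_zero)
next
  case (eng h1 h2)
  then show ?case by (simp add: tensor_free_def mult_free_add)
qed

lemma tensor_rels_subset_kernel: "tensor_rels R A B \<subseteq> tensor_kernel R A B"
  by (auto simp: tensor_kernel_def intro: generate.incl)

lemma Rq_kernel_add_left:
  assumes "P \<in> Rq_plus" "Q \<in> Rq_plus" "c \<in> Zq_laurent"
  shows "frag_of (P + Q, c) - frag_of (P, c) - frag_of (Q, c) \<in> Rq_kernel"
proof -
  have "frag_of (P + Q, c) - frag_of (P, c) - frag_of (Q, c) \<in> Rq_rels"
    unfolding tensor_rels_def Rq_alg_simps using assms by blast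
  then show ?thesis using tensor_rels_subset_kernel by (rule subsetD[rotated])
qed

lemma Rq_kernel_balanced:
  assumes "r \<in> Zq" "P \<in> Rq_plus" "c \<in> Zq_laurent"
  shows "frag_of (Polynomial.smult r P, c) - frag_of (P, r * c) \<in> Rq_kernel"
proof -
  have "frag_of (Polynomial.smult r P, c) - frag_of (P, r * c) \<in> Rq_rels"
    unfolding tensor_rels_def Rq_alg_simps using assms by blast
  then show ?thesis using tensor_rels_subset_kernel by (rule subsetD[rotated])
qed

text \<open>The additivity relation for \<open>0 + 0 = 0\<close> is \<open>- (0, c)\<close>.\<close>

lemma Rq_kernel_zero_left:
  assumes "c \<in> Zq_laurent" shows "frag_of (0, c) \<in> Rq_kernel"
  using Rq_kernel_uminus[OF Rq_kernel_add_left[OF Rq_plus_closed(1) Rq_plus_closed(1) assms]] by simp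

lemma Rq_kernel_raise_denominator:
  assumes "P \<in> Rq_plus" "k \<le> l"
  shows "frag_of (P, 1 / qvar ^ k) - frag_of (Polynomial.smult (qvar ^ (l - k)) P, 1 / qvar ^ l) \<in> Rq_kernel"
proof -
  have "qvar ^ l = qvar ^ (l - k) * qvar ^ k" using assms(2) by (simp add: power_add[symmetric])
  then have "qvar ^ (l - k) * (1 / qvar ^ l) = 1 / qvar ^ k" using qvar_nonzero by simp
  then show ?thesis
    using Rq_kernel_uminus[OF Rq_kernel_balanced[OF Zq_closed(7)[OF qvar_mem_Zq, of "l - k"] assms(1)
      inverse_qvar_power_mem[of l]]] by simp
qed

text \<open>
  For a generator \<open>(P, c q^-k)\<close> the numerator \<open>c \<in> \<int>[q]\<close> moves to the left factor.  For a difference,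
  both normal forms are first rewritten with the larger of the two denominators, after which the
  additivity relation combines them.
\<close>

lemma tensor_normal_form:
  assumes "z \<in> carrier Rq_free"
  shows "\<exists>P\<in>Rq_plus. \<exists>k. z - frag_of (P, 1 / qvar ^ k) \<in> Rq_kernel"
proof -
  have "Poly_Mapping.keys z \<subseteq> Rq_plus \<times> Zq_laurent"
    using assms by (simp add: tensor_free_def Rq_alg_simps)
  then show ?thesis
  proof (induction rule: frag_induction)
    case zero
    have "0 - frag_of (0, 1 / qvar ^ 0) \<in> Rq_kernel"
      using Rq_kernel_diff[OF Rq_kernel_zero Rq_kernel_zero_left[OF inverse_qvar_power_mem]] .
    then show ?case using Rq_plus_closed(1) by blast
  next
    case (one x)
    then obtain P c k where x: "x = (P, c / qvar ^ k)" and P: "P \<in> Rq_plus" and c: "c \<in> Zq"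
      by (auto simp: Zq_laurent_def)
    have "frag_of x - frag_of (Polynomial.smult c P, 1 / qvar ^ k) \<in> Rq_kernel"
      using Rq_kernel_uminus[OF Rq_kernel_balanced[OF c P inverse_qvar_power_mem[of k]]] by (simp add: x)
    then show ?case using Rq_plus_closed(4)[OF c P] by blast
  next
    case (diff a b)
    then obtain P k Q l where P: "P \<in> Rq_plus" "a - frag_of (P, 1 / qvar ^ k) \<in> Rq_kernel"
      and Q: "Q \<in> Rq_plus" "b - frag_of (Q, 1 / qvar ^ l) \<in> Rq_kernel" by blast
    define m where "m = max k l"
    let ?u = "1 / qvar ^ m"
    define P' where "P' = Polynomial.smult (qvar ^ (m - k)) P"
    define Q' where "Q' = Polynomial.smult (qvar ^ (m - l)) Q"
    have mem: "P' \<in> Rq_plus" "Q' \<in> Rq_plus"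
      unfolding P'_def Q'_def using P Q qvar_mem_Zq by (simp_all add: Rq_plus_closed Zq_closed)
    have P': "a - frag_of (P', ?u) \<in> Rq_kernel"
      using Rq_kernel_add[OF P(2) Rq_kernel_raise_denominator[OF P(1), of k m]]
      by (simp add: P'_def m_def)
    have Q': "b - frag_of (Q', ?u) \<in> Rq_kernel"
      using Rq_kernel_add[OF Q(2) Rq_kernel_raise_denominator[OF Q(1), of l m]]
      by (simp add: Q'_def m_def)
    \<comment> \<open>the additivity relation for \<open>P' = (P' - Q') + Q'\<close>\<close>
    have "frag_of (P', ?u) - frag_of (P' - Q', ?u) - frag_of (Q', ?u) \<in> Rq_kernel"
      using Rq_kernel_add_left[OF Rq_plus_closed(3)[OF mem] mem(2) inverse_qvar_power_mem[of m]] by simp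
    from Rq_kernel_add[OF this Rq_kernel_diff[OF P' Q']]
    have "(a - b) - frag_of (P' - Q', ?u) \<in> Rq_kernel" by (simp add: algebra_simps)
    then show ?case using Rq_plus_closed(3)[OF mem] by blast
  qed
qed

text \<open>
  In normal form the image is \<open>q^-k P\<close>, and \<open>\<rat>(q)[x]\<close> has no
  \<open>q\<close>-torsion.
\<close>

lemma mult_free_eq_0_imp_kernel:
  assumes z: "z \<in> carrier Rq_free" and "mult_free z = 0"
  shows "z \<in> Rq_kernel"
proof -
  obtain P k where k: "z - frag_of (P, 1 / qvar ^ k) \<in> Rq_kernel"
    using tensor_normal_form[OF z] by blast
  have "Polynomial.smult (1 / qvar ^ k) P = 0"
    using mult_free_Rq_kernel[OF k] assms(2) by (simp add: mult_free_diff)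
  then have "P = 0" using qvar_nonzero by simp
  then show ?thesis
    using Rq_kernel_add[OF k Rq_kernel_zero_left[OF inverse_qvar_power_mem[of k]]] by simp
qed

section \<open>The multiplication map on the tensor product\<close>

lemma mult_map_eqI:
  assumes "X \<noteq> {}" "\<And>z. z \<in> X \<Longrightarrow> mult_free z = v"
  shows "mult_map X = v"
proof -
  have "mult_free ` X = {v}" using assms by force
  then show ?thesis by (simp add: mult_map_def)
qed

lemma coset_eq: "Rq_kernel +>\<^bsub>Rq_free\<^esub> a = (\<lambda>h. h + a) ` Rq_kernel"
  by (auto simp: a_r_coset_def r_coset_def tensor_free_def)

lemma mult_free_coset: "z \<in> Rq_kernel +>\<^bsub>Rq_free\<^esub> a \<Longrightarrow> mult_free z = mult_free a"
  by (auto simp: coset_eq mult_free_add mult_free_Rq_kernel)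

lemma coset_nonempty: "Rq_kernel +>\<^bsub>Rq_free\<^esub> a \<noteq> {}"
  using Rq_kernel_zero by (auto simp: coset_eq)

lemma mult_map_coset: "mult_map (Rq_kernel +>\<^bsub>Rq_free\<^esub> a) = mult_free a"
  by (rule mult_map_eqI[OF coset_nonempty mult_free_coset])

lemma carrier_Rq_tensor: "carrier Rq_tensor = (\<lambda>a. Rq_kernel +>\<^bsub>Rq_free\<^esub> a) ` carrier Rq_free"
  by (auto simp: tensor_algebra_def FactRing_def A_RCOSETS_def RCOSETS_def a_r_coset_def)

text \<open>
  The product of two cosets is by definition the union of the cosets of all products of
  representatives.  On that union \<open>mult_free\<close> takes a single value, since it is multiplicative on
  formal sums and vanishes on the kernel.
\<close>

lemma mult_map_ring_hom: "mult_map \<in> ring_hom Rq_tensor Qqx_ring"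
proof (rule ring_hom_memI)
  show "mult_map x \<in> carrier Qqx_ring" for x by (simp add: Qqx_ring_def)
  show "mult_map \<one>\<^bsub>Rq_tensor\<^esub> = \<one>\<^bsub>Qqx_ring\<^esub>"
    by (simp add: tensor_algebra_def FactRing_def mult_map_coset)
       (simp add: tensor_free_def Rq_alg_simps Qqx_ring_def)
  fix X Y assume "X \<in> carrier Rq_tensor" "Y \<in> carrier Rq_tensor"
  then obtain a b where X: "X = Rq_kernel +>\<^bsub>Rq_free\<^esub> a" and Y: "Y = Rq_kernel +>\<^bsub>Rq_free\<^esub> b"
    by (auto simp: carrier_Rq_tensor)
  have "X \<otimes>\<^bsub>Rq_tensor\<^esub> Y = (\<Union>x\<in>X. \<Union>y\<in>Y. Rq_kernel +>\<^bsub>Rq_free\<^esub> (x \<otimes>\<^bsub>Rq_free\<^esub> y))"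
    by (simp add: tensor_algebra_def FactRing_def rcoset_mult_def)
  moreover have "mult_map \<dots> = mult_free a * mult_free b"
    using coset_nonempty
    by (intro mult_map_eqI) (auto simp: X Y mult_free_mult dest!: mult_free_coset)
  ultimately show "mult_map (X \<otimes>\<^bsub>Rq_tensor\<^esub> Y) = mult_map X \<otimes>\<^bsub>Qqx_ring\<^esub> mult_map Y"
    by (simp add: X Y mult_map_coset Qqx_ring_def)
  have "X \<oplus>\<^bsub>Rq_tensor\<^esub> Y = (\<Union>x\<in>X. \<Union>y\<in>Y. {x + y})"
    by (simp add: tensor_algebra_def FactRing_def set_add_def set_mult_def)
       (simp add: tensor_free_def)
  moreover have "mult_map \<dots> = mult_free a + mult_free b"
    using coset_nonempty
    by (intro mult_map_eqI) (auto simp: X Y mult_free_add dest!: mult_free_coset)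
  ultimately show "mult_map (X \<oplus>\<^bsub>Rq_tensor\<^esub> Y) = mult_map X \<oplus>\<^bsub>Qqx_ring\<^esub> mult_map Y"
    by (simp add: X Y mult_map_coset Qqx_ring_def)
qed

lemma mult_map_inj: "inj_on mult_map (carrier Rq_tensor)"
proof (rule inj_onI)
  fix X Y assume "X \<in> carrier Rq_tensor" "Y \<in> carrier Rq_tensor" and eq: "mult_map X = mult_map Y"
  then obtain a b where ab: "a \<in> carrier Rq_free" "b \<in> carrier Rq_free"
    and X: "X = Rq_kernel +>\<^bsub>Rq_free\<^esub> a" and Y: "Y = Rq_kernel +>\<^bsub>Rq_free\<^esub> b"
    by (auto simp: carrier_Rq_tensor)
  have "a - b \<in> carrier Rq_free"
    using ab by (rule tensor_free_diff)
  moreover have "mult_free (a - b) = 0"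
    using eq by (simp add: X Y mult_map_coset mult_free_diff)
  ultimately have d: "a - b \<in> Rq_kernel" by (rule mult_free_eq_0_imp_kernel)
  have "h + a \<in> (\<lambda>h. h + b) ` Rq_kernel" if "h \<in> Rq_kernel" for h
    using Rq_kernel_add[OF that d] by (intro image_eqI[of _ _ "h + (a - b)"]) auto
  moreover have "h + b \<in> (\<lambda>h. h + a) ` Rq_kernel" if "h \<in> Rq_kernel" for h
    using Rq_kernel_diff[OF that d] by (intro image_eqI[of _ _ "h - (a - b)"]) auto
  ultimately show "X = Y" unfolding X Y coset_eq by blast
qed

text \<open>
  This is the arithmetic content of the result: \<open>R\<^sub>q\<close> is the localization of \<open>R\<^sub>q\<^sup>+\<close> at the powers
  of \<open>q\<close>.
\<close>

lemma Rq_eq_smult_Rq_plus: "Rq = {Polynomial.smult (1 / qvar ^ k) P | P k. P \<in> Rq_plus}"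
proof (intro subset_antisym subsetI)
  fix P assume "P \<in> Rq"
  then obtain k where "Polynomial.smult (qvar ^ k) P \<in> Rq_plus" using Rq_common_denominator by blast
  moreover have "P = Polynomial.smult (1 / qvar ^ k) (Polynomial.smult (qvar ^ k) P)" using qvar_nonzero by simp
  ultimately show "P \<in> {Polynomial.smult (1 / qvar ^ k) P | P k. P \<in> Rq_plus}" by blast
next
  fix P assume "P \<in> {Polynomial.smult (1 / qvar ^ k) P | P k. P \<in> Rq_plus}"
  then show "P \<in> Rq" using Rq_plus_subset_Rq Rq_smult inverse_qvar_power_mem by blast
qed

lemma mult_map_image: "mult_map ` carrier Rq_tensor = Rq"
proof -
  have "mult_map ` carrier Rq_tensor = mult_free ` carrier Rq_free"
    by (simp add: carrier_Rq_tensor image_image mult_map_coset)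
  also have "\<dots> = {Polynomial.smult (1 / qvar ^ k) P | P k. P \<in> Rq_plus}"
  proof (intro subset_antisym subsetI)
    fix v assume "v \<in> mult_free ` carrier Rq_free"
    then obtain z where z: "z \<in> carrier Rq_free" "v = mult_free z" by blast
    obtain P k where P: "P \<in> Rq_plus" "z - frag_of (P, 1 / qvar ^ k) \<in> Rq_kernel"
      using tensor_normal_form[OF z(1)] by blast
    have "v = Polynomial.smult (1 / qvar ^ k) P"
      using mult_free_Rq_kernel[OF P(2)] z(2) by (simp add: mult_free_diff)
    then show "v \<in> {Polynomial.smult (1 / qvar ^ k) P | P k. P \<in> Rq_plus}" using P(1) by blast
  next
    fix v assume "v \<in> {Polynomial.smult (1 / qvar ^ k) P | P k. P \<in> Rq_plus}"
    then obtain P k where P: "P \<in> Rq_plus" "v = Polynomial.smult (1 / qvar ^ k) P" by blast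
    then have "frag_of (P, 1 / qvar ^ k) \<in> carrier Rq_free"
      using inverse_qvar_power_mem by (simp add: frag_of_mem_Rq_free)
    then show "v \<in> mult_free ` carrier Rq_free" using P(2) by (metis imageI mult_free_frag_of)
  qed
  finally show ?thesis using Rq_eq_smult_Rq_plus by simp
qed

theorem proposition4p3:
  shows "(\<forall>P \<in> Rq_plus. \<forall>c \<in> Zq_laurent. mult_map (Rq_pure P c) = Polynomial.smult c P)
    \<and> mult_map \<in> ring_hom Rq_tensor Qqx_ring
    \<and> inj_on mult_map (carrier Rq_tensor)
    \<and> Rq = mult_map ` carrier Rq_tensor"
  using mult_map_ring_hom mult_map_inj mult_map_image
  by (simp add: pure_tensor_def mult_map_coset)

end
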